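(* Let $d\ge1$ and let $H$ be a hypergraph of $d$-intervals. Then (1) $\tau(H)\le(d^2-d+1)\,\nu(H)$, and (2) $\tau(H)\le d\,\nu^*(H)$.
   Context: A $d$-interval is a union of at most $d$ pairwise disjoint closed intervals of the real line $\mathbb{R}$. A hypergraph of $d$-intervals is a finite family $H$ of $d$-intervals, regarded as a hypergraph whose vertices are the points of $\mathbb{R}$ and whose edges are the members of $H$. A matching is a set of pairwise disjoint edges and $\nu(H)$ is the maximum size of a matching. A cover is a set of points meeting every edge and $\tau(H)$ is the minimum size of a cover. A fractional matching is $f:H\to\mathbb{R}_{\ge0}$ with $\sum_{h\ni v}f(h)\le1$ for every point $v$; $\nu^*(H)$ is the maximum of $\sum_h f(h)$ over fractional matchings. *)

theory Defs
  imports Complex_Main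
begin

definition d_interval :: "nat \<Rightarrow> real set \<Rightarrow> bool" where
  "d_interval d S \<longleftrightarrow> (\<exists>k (a::nat \<Rightarrow> real) b. 1 \<le> k \<and> k \<le> d \<and>
     (\<forall>i<k. a i \<le> b i) \<and>
     (\<forall>i<k. \<forall>j<k. i \<noteq> j \<longrightarrow> {a i..b i} \<inter> {a j..b j} = {}) \<and>
     S = (\<Union>i<k. {a i..b i}))"

definition matching :: "real set set \<Rightarrow> real set set \<Rightarrow> bool" where
  "matching H M \<longleftrightarrow> M \<subseteq> H \<and> pairwise disjnt M"

definition nu :: "real set set \<Rightarrow> nat" where
  "nu H = Max (card ` {M. matching H M})"

definition cover :: "real set set \<Rightarrow> real set \<Rightarrow> bool" where
  "cover H C \<longleftrightarrow> finite C \<and> (\<forall>h\<in>H. C \<inter> h \<noteq> {})"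

definition tau :: "real set set \<Rightarrow> nat" where
  "tau H = (LEAST n. \<exists>C. cover H C \<and> card C = n)"

definition fractional_matching :: "real set set \<Rightarrow> (real set \<Rightarrow> real) \<Rightarrow> bool" where
  "fractional_matching H f \<longleftrightarrow> (\<forall>h\<in>H. f h \<ge> 0) \<and>
     (\<forall>v. (\<Sum>h\<in>{h\<in>H. v \<in> h}. f h) \<le> 1)"

definition nu_star :: "real set set \<Rightarrow> real" where
  "nu_star H = Sup {(\<Sum>h\<in>H. f h) | f. fractional_matching H f}"

end

(*
Suppose that tau H = n + 1 and that H lies in an open interval (lo, hi). Any n cut points split
(lo, hi) into n + 1 pieces and miss some edge of H; an edge missed by the cuts meets at most d pieces.
Let F_i be the sum, over the edges h meeting the i-th piece, of the product of the distances from the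
cuts to h. F_i is continuous in the cuts and vanishes when the i-th piece degenerates, so by the
Poincare-Miranda theorem all F_i agree for some choice of cuts. After normalisation the weights form
a fractional matching of H which, read on the n + 1 pieces, loads every piece by exactly 1; since
every edge meets at most d pieces, its total is at least (n + 1) / d. This is (2).

For (1), apply Furedi's bound nu* <= (d - 1 + 1/d) nu for hypergraphs of rank d to the traces of the
edges on the pieces: disjoint traces come from disjoint edges. Furedi's bound is greedy: a vertex of
the fractional matching polytope has at least as many saturated points as edges in its support, so
some edge has weight at least 1/d, and the edges meeting it have total weight at most d - (d - 1)/d.
*)

theory Submission
  imports Defs "HOL-Analysis.Analysis"
begin

section \<open>The Poincare-Miranda theorem\<close>

lemma tendsto_fun_componentwise:
  fixes f :: "'c \<Rightarrow> 'a \<Rightarrow> 'b::topological_space"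
  assumes "\<And>i. ((\<lambda>c. f c i) \<longlongrightarrow> l i) F"
  shows "(f \<longlongrightarrow> l) F"
proof -
  have "limitin (product_topology (\<lambda>i. euclidean) UNIV) f l F"
    using assms by (simp add: limitin_componentwise)
  then show ?thesis
    by (simp add: euclidean_product_topology)
qed

text \<open>Tychonoff's theorem, read through the identification of the topology on functions with
  the product topology.\<close>

lemma compact_unit_cube: "compact (UNIV \<rightarrow> {0..1::real})"
proof -
  have "compactin (product_topology (\<lambda>i::'a. euclidean) UNIV) (PiE UNIV (\<lambda>i. {0..1::real}))"
    by (simp add: compactin_PiE)
  then show ?thesis
    by (simp add: euclidean_product_topology PiE_UNIV_domain)
qed

text \<open>Points of the cube of dimension \<open>n\<close> are sequences of which only the first \<open>n\<close> entries matter,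
  so that the dimension need not be a type.\<close>

theorem poincare_miranda:
  fixes g :: "nat \<Rightarrow> (nat \<Rightarrow> real) \<Rightarrow> real"
  assumes cont: "\<And>i. i < n \<Longrightarrow> continuous_on (UNIV \<rightarrow> {0..1}) (g i)"
    and low: "\<And>i x. i < n \<Longrightarrow> x \<in> UNIV \<rightarrow> {0..1} \<Longrightarrow> x i = 0 \<Longrightarrow> g i x \<le> 0"
    and high: "\<And>i x. i < n \<Longrightarrow> x \<in> UNIV \<rightarrow> {0..1} \<Longrightarrow> x i = 1 \<Longrightarrow> g i x \<ge> 0"
  obtains x where "x \<in> UNIV \<rightarrow> {0..1}" and "\<And>i. i < n \<Longrightarrow> g i x = 0"
proof -
  \<comment> \<open>\<open>sc k\<close> scales an integer grid point to mesh 1/(k+1). Entries from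
    \<open>n\<close> on are set to 0, so that the result lies in the cube whatever \<open>u\<close>
    does there.\<close>
  define sc :: "nat \<Rightarrow> (nat \<Rightarrow> nat) \<Rightarrow> nat \<Rightarrow> real"
    where "sc = (\<lambda>k u j. if j < n then real (u j) / real (Suc k) else 0)"
  have sc_cube: "sc k u \<in> UNIV \<rightarrow> {0..1}" if "\<forall>i<n. u i \<le> Suc k" for k u
    using that by (auto simp: sc_def divide_simps)
  define near :: "(nat \<Rightarrow> nat) \<Rightarrow> (nat \<Rightarrow> nat) \<Rightarrow> bool"
    where "near = (\<lambda>q u. \<forall>j<n. q j \<le> u j \<and> u j \<le> q j + 1)"
  have "\<exists>q. (\<forall>i<n. q i < Suc k) \<and>
      (\<forall>i<n. \<exists>r s. near q r \<and> near q s \<and> g i (sc k r) \<le> 0 \<and> 0 \<le> g i (sc k s))" for k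
  proof -
    \<comment> \<open>The label records the sign of \<open>g i\<close>, except on the two faces of
      direction \<open>i\<close>, where Kuhn's lemma prescribes it. There \<open>low\<close> and
      \<open>high\<close> guarantee that the prescribed label still agrees with the sign.\<close>
    define label :: "(nat \<Rightarrow> nat) \<Rightarrow> nat \<Rightarrow> nat" where
      "label = (\<lambda>u i. if u i = 0 then 0 else if u i = Suc k then 1
                      else if g i (sc k u) \<le> 0 then 0 else 1)"
    have label0: "g i (sc k u) \<le> 0" if "label u i = 0" "i < n" "\<forall>i<n. u i \<le> Suc k" for u i
      using that low[of i "sc k u"] sc_cube[of u k]
      by (auto simp: label_def sc_def split: if_splits)
    have label1: "0 \<le> g i (sc k u)" if "label u i \<noteq> 0" "i < n" "\<forall>i<n. u i \<le> Suc k" for u i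
      using that high[of i "sc k u"] sc_cube[of u k]
      by (auto simp: label_def sc_def split: if_splits)
    have lab_range: "label u i = 0 \<or> label u i = 1" for u i
      by (simp add: label_def)
    \<comment> \<open>Kuhn's lemma yields a grid cell with lowest corner \<open>q\<close> in which,
      for every coordinate, both labels occur at vertices.\<close>
    obtain q where q: "\<forall>i<n. q i < Suc k"
      and qrs: "\<forall>i<n. \<exists>r s. near q r \<and> near q s \<and> label r i \<noteq> label s i"
      unfolding near_def by (rule kuhn_lemma[of "Suc k" n label]) (auto simp: label_def)
    have "\<exists>r s. near q r \<and> near q s \<and> g i (sc k r) \<le> 0 \<and> 0 \<le> g i (sc k s)" if "i < n" for i
    proof -
      obtain r s where r: "near q r" and s: "near q s" and ne: "label r i \<noteq> label s i"
        using qrs \<open>i < n\<close> by blast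
      have rb: "\<forall>j<n. r j \<le> Suc k" and sb: "\<forall>j<n. s j \<le> Suc k"
        using r s q unfolding near_def by (metis Suc_eq_plus1 Suc_leI le_trans)+
      show ?thesis
      proof (cases "label r i = 0")
        case True
        then show ?thesis
          using label0[OF _ \<open>i < n\<close> rb] label1[OF _ \<open>i < n\<close> sb] r s ne by metis
      next
        case False
        then have "label s i = 0"
          using ne lab_range by metis
        then show ?thesis
          using False label1[OF _ \<open>i < n\<close> rb] label0[OF _ \<open>i < n\<close> sb] r s by metis
      qed
    qed
    then show ?thesis
      using q by blast
  qed
  then have "\<exists>Q. \<forall>k. (\<forall>i<n. Q k i < Suc k) \<and> (\<forall>i<n. \<exists>r s.
      near (Q k) r \<and> near (Q k) s \<and> g i (sc k r) \<le> 0 \<and> 0 \<le> g i (sc k s))"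
    by (intro choice) blast
  then obtain Q where Q: "\<And>k i. i < n \<Longrightarrow> Q k i < Suc k"
    and Qrs: "\<And>k i. i < n \<Longrightarrow>
      \<exists>r s. near (Q k) r \<and> near (Q k) s \<and> g i (sc k r) \<le> 0 \<and> 0 \<le> g i (sc k s)"
    by blast
  have "\<forall>k. sc k (Q k) \<in> UNIV \<rightarrow> {0..1}"
    using Q by (intro allI sc_cube) (simp add: less_imp_le)
  then obtain x l where x: "x \<in> UNIV \<rightarrow> {0..1}" and l: "strict_mono l"
    and lim: "((\<lambda>k. sc k (Q k)) \<circ> l) \<longlonglongrightarrow> x"
    by (rule seq_compactE[OF compact_imp_seq_compact[OF compact_unit_cube]])
  \<comment> \<open>The cells shrink, so any choice of one vertex per cell has the limit
    \<open>x\<close> along the subsequence. Hence \<open>g i x\<close> is a limit both of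
    nonpositive and of nonnegative values.\<close>
  have close: "(\<lambda>k. sc (l k) (U (l k))) \<longlonglongrightarrow> x"
    if U: "\<And>k. near (Q k) (U k)" for U
  proof (rule tendsto_fun_componentwise)
    fix j
    have limj: "(\<lambda>k. sc (l k) (Q (l k)) j) \<longlonglongrightarrow> x j"
      using lim continuous_on_tendsto_compose[OF continuous_on_product_coordinates[of j] lim]
      by (simp add: o_def)
    have inv0: "(\<lambda>k. inverse (real (Suc (l k)))) \<longlonglongrightarrow> 0"
      using LIMSEQ_subseq_LIMSEQ[OF LIMSEQ_inverse_real_of_nat l] by (simp add: o_def)
    have "\<bar>sc (l k) (U (l k)) j - sc (l k) (Q (l k)) j\<bar> \<le> inverse (real (Suc (l k)))" for k
      using U[of "l k"] by (auto simp: near_def sc_def divide_simps)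
    then have "(\<lambda>k. sc (l k) (U (l k)) j - sc (l k) (Q (l k)) j) \<longlonglongrightarrow> 0"
      by (intro Lim_null_comparison[OF _ inv0]) auto
    from tendsto_add[OF this limj] show "(\<lambda>k. sc (l k) (U (l k)) j) \<longlonglongrightarrow> x j"
      by simp
  qed
  have inK: "sc k (U k) \<in> UNIV \<rightarrow> {0..1}"
    if "\<And>k. near (Q k) (U k)" for U k
    using that[of k] Q[of _ k] unfolding near_def by (intro sc_cube) (metis Suc_eq_plus1 Suc_leI le_trans)
  have "g i x = 0" if i: "i < n" for i
  proof (rule antisym)
    have glim: "(\<lambda>k. g i (sc (l k) (U (l k)))) \<longlonglongrightarrow> g i x"
      if U: "\<And>k. near (Q k) (U k)" for U
      using continuous_on_tendsto_compose[OF cont[OF i] close[OF U] x] inK[OF U] by simp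
    obtain R where R: "\<And>k. near (Q k) (R k)" "\<And>k. g i (sc k (R k)) \<le> 0"
      using Qrs[OF i] by metis
    obtain S where S: "\<And>k. near (Q k) (S k)" "\<And>k. 0 \<le> g i (sc k (S k))"
      using Qrs[OF i] by metis
    show "g i x \<le> 0"
      by (rule LIMSEQ_le_const2[OF glim[OF R(1)]]) (use R(2) in blast)
    show "0 \<le> g i x"
      by (rule LIMSEQ_le_const[OF glim[OF S(1)]]) (use S(2) in blast)
  qed
  with x show thesis
    using that by blast
qed

section \<open>Linear algebra and the ratio test, for reaching vertices of a polytope\<close>

text \<open>Gaussian elimination, by induction on the equations: equation \<open>v\<close> either
  vanishes on \<open>E\<close> or expresses some unknown \<open>e\<close> through the others.
  \<open>B\<close> is the system after this substitution, and \<open>c\<close> is the value of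
  \<open>e\<close> that equation \<open>v\<close> then forces.\<close>

lemma homogeneous_system_nontrivial_solution:
  fixes A :: "'v \<Rightarrow> 'e \<Rightarrow> 'a::field"
  assumes "finite S" "finite E" "card S < card E"
  obtains z where "\<And>e. e \<notin> E \<Longrightarrow> z e = 0" "\<exists>e\<in>E. z e \<noteq> 0" "\<And>v. v \<in> S \<Longrightarrow> (\<Sum>e\<in>E. A v e * z e) = 0"
proof -
  have "\<exists>z. (\<forall>e. e \<notin> E \<longrightarrow> z e = 0) \<and> (\<exists>e\<in>E. z e \<noteq> 0) \<and> (\<forall>v\<in>S. (\<Sum>e\<in>E. A v e * z e) = 0)"
    using assms
  proof (induction S arbitrary: A E rule: finite_induct)
    case empty
    then obtain e where "e \<in> E"
      by fastforce
    then show ?case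
      by (intro exI[of _ "\<lambda>x. if x = e then 1 else 0"]) auto
  next
    case (insert v S)
    show ?case
    proof (cases "\<exists>e\<in>E. A v e \<noteq> 0")
      case False
      then show ?thesis
        using insert.IH[of E A] insert by auto
    next
      case True
      then obtain e where e: "e \<in> E" "A v e \<noteq> 0"
        by blast
      define B where "B = (\<lambda>u x. A u x - A u e * A v x / A v e)"
      have "card S < card (E - {e})"
        using insert e by simp
      then obtain z where z0: "\<forall>x. x \<notin> E - {e} \<longrightarrow> z x = 0" and z1: "\<exists>x\<in>E - {e}. z x \<noteq> 0"
        and zB: "\<forall>u\<in>S. (\<Sum>x\<in>E - {e}. B u x * z x) = 0"
        using insert.IH[of "E - {e}" B] insert.prems by auto
      define c where "c = - (\<Sum>x\<in>E - {e}. A v x * z x) / A v e"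
      define y where "y = z(e := c)"
      have split: "(\<Sum>x\<in>E. A u x * y x) = A u e * c + (\<Sum>x\<in>E - {e}. A u x * z x)" for u
        using sum.remove[OF \<open>finite E\<close> e(1), of "\<lambda>x. A u x * y x"] by (auto simp: y_def)
      have "(\<Sum>x\<in>E. A u x * y x) = 0" if "u \<in> insert v S" for u
      proof (cases "u = v")
        case True
        then show ?thesis
          using e by (simp add: split c_def)
      next
        case False
        then have "(\<Sum>x\<in>E - {e}. B u x * z x) = 0"
          using that zB by blast
        then have "(\<Sum>x\<in>E - {e}. A u x * z x) = A u e / A v e * (\<Sum>x\<in>E - {e}. A v x * z x)"
          by (simp add: B_def algebra_simps sum_subtractf sum_distrib_left)
        then show ?thesis
          using e by (simp add: split c_def)
      qed
      moreover have "\<exists>x\<in>E. y x \<noteq> 0"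
        using z1 by (auto simp: y_def)
      moreover have "\<forall>x. x \<notin> E \<longrightarrow> y x = 0"
        using z0 e by (auto simp: y_def)
      ultimately show ?thesis
        by blast
    qed
  qed
  then show thesis
    using that by blast
qed

text \<open>The ratio test of the simplex method. \<open>a c\<close> is the slack of constraint
  \<open>c\<close> and \<open>b c\<close> its rate of change; \<open>t\<close> is the first moment
  at which a decreasing slack runs out. Tight constraints do not move, which makes \<open>t\<close>
  positive.\<close>

lemma affine_step_to_boundary:
  fixes a b :: "'c \<Rightarrow> real"
  assumes "finite C" and nonneg: "\<And>c. c \<in> C \<Longrightarrow> 0 \<le> a c"
    and "\<And>c. c \<in> C \<Longrightarrow> a c = 0 \<Longrightarrow> b c = 0"
    and "\<exists>c\<in>C. b c < 0"
  obtains t where "t > 0" "\<And>c. c \<in> C \<Longrightarrow> 0 \<le> a c + t * b c" "\<exists>c\<in>C. a c > 0 \<and> a c + t * b c = 0"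
proof -
  let ?D = "{c \<in> C. b c < 0}"
  define t where "t = Min ((\<lambda>c. a c / - b c) ` ?D)"
  have D: "finite ?D" "?D \<noteq> {}"
    using assms by auto
  have pos: "a c > 0" if "c \<in> ?D" for c
    using that assms(2,3)[of c] by force
  have tle: "t \<le> a c / - b c" if "c \<in> ?D" for c
    unfolding t_def using that D by (intro Min_le) auto
  have "t \<in> (\<lambda>c. a c / - b c) ` ?D"
    unfolding t_def using D by (intro Min_in) auto
  then obtain c where c: "c \<in> ?D" "t = a c / - b c"
    by blast
  have "t > 0"
    using c pos[of c] by (simp add: divide_pos_neg)
  moreover have "0 \<le> a e + t * b e" if "e \<in> C" for e
  proof (cases "b e < 0")
    case True
    then show ?thesis
      using tle[of e] that by (simp add: field_simps)
  next
    case False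
    then show ?thesis
      using nonneg[OF that] \<open>t > 0\<close> by simp
  qed
  moreover have "\<exists>c\<in>C. a c > 0 \<and> a c + t * b c = 0"
    using c pos[of c] by (intro bexI[of _ c]) auto
  ultimately show thesis
    using that by blast
qed

section \<open>Furedi's bound\<close>

text \<open>A fractional matching of an indexed hypergraph. Edges are indices because different
  \<open>d\<close>-intervals may leave the same trace on the pieces, and their weights must be
  counted separately.\<close>

definition packing :: "'e set \<Rightarrow> ('e \<Rightarrow> 'v set) \<Rightarrow> ('e \<Rightarrow> real) \<Rightarrow> bool" where
  "packing E T w \<longleftrightarrow> (\<forall>e\<in>E. 0 \<le> w e) \<and> (\<forall>v. (\<Sum>e\<in>{e\<in>E. v \<in> T e}. w e) \<le> 1)"

lemma packing_subset:
  assumes "packing E T w" "F \<subseteq> E" "finite E"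
  shows "packing F T w"
proof -
  have "(\<Sum>e\<in>{e\<in>F. v \<in> T e}. w e) \<le> (\<Sum>e\<in>{e\<in>E. v \<in> T e}. w e)" for v
    using assms by (intro sum_mono2) (auto simp: packing_def)
  then show ?thesis
    using assms unfolding packing_def by (meson order_trans subsetD)
qed

text \<open>While the support is larger than the set of saturated points, some nonzero direction on
  the support leaves all saturated loads unchanged. Moving along it to the boundary kills an edge or
  saturates a point, while zero weights stay zero and saturated points stay saturated, so the
  process ends.\<close>

lemma packing_vertex_reduction:
  fixes T :: "'e \<Rightarrow> 'v set"
  assumes fin: "finite E" "\<And>e. e \<in> E \<Longrightarrow> finite (T e)" "\<And>e. e \<in> E \<Longrightarrow> T e \<noteq> {}"
    and "packing E T w"
  obtains u where "packing E T u" "sum w E \<le> sum u E"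
    "card {e\<in>E. u e \<noteq> 0} \<le> card {v \<in> \<Union>(T ` E). (\<Sum>e\<in>{e\<in>E. v \<in> T e}. u e) = 1}"
proof -
  define V where "V = \<Union>(T ` E)"
  have finV: "finite V"
    using fin by (auto simp: V_def)
  define load where "load = (\<lambda>u v. \<Sum>e\<in>{e\<in>E. v \<in> T e}. u e :: real)"
  define supp where "supp = (\<lambda>u. {e\<in>E. u e \<noteq> (0::real)})"
  define loose where "loose = (\<lambda>u. {v\<in>V. load u v \<noteq> 1})"
  have finS: "finite (supp u)" "finite (loose u)" for u
    using fin finV by (auto simp: supp_def loose_def)
  have "\<exists>u. packing E T u \<and> sum w E \<le> sum u E \<and> card (supp u) \<le> card {v\<in>V. load u v = 1}"
    using \<open>packing E T w\<close>
  proof (induction "card (supp w) + card (loose w)" arbitrary: w rule: less_induct)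
    case less
    note pw = \<open>packing E T w\<close>
    show ?case
    proof (cases "card (supp w) \<le> card {v\<in>V. load w v = 1}")
      case True
      then show ?thesis
        using pw by blast
    next
      case False
      have finTight: "finite {v\<in>V. load w v = 1}"
        using finV by simp
      from False have "card {v\<in>V. load w v = 1} < card (supp w)"
        by simp
      then obtain y where y: "\<And>e. e \<notin> supp w \<Longrightarrow> y e = 0" "\<exists>e\<in>supp w. y e \<noteq> 0"
          "\<And>v. v \<in> {v\<in>V. load w v = 1} \<Longrightarrow> (\<Sum>e\<in>supp w. of_bool (v \<in> T e) * y e) = (0::real)"
        by (rule homogeneous_system_nontrivial_solution[OF finTight finS(1)[of w],
              where A = "\<lambda>v e. of_bool (v \<in> T e)"]) blast
      have loady: "load y v = (\<Sum>e\<in>supp w. of_bool (v \<in> T e) * y e)" for v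
      proof -
        have "load y v = (\<Sum>e\<in>E. of_bool (v \<in> T e) * y e)"
          using fin by (simp add: load_def Int_def)
        also have "\<dots> = (\<Sum>e\<in>supp w. of_bool (v \<in> T e) * y e)"
          using fin y(1) by (intro sum.mono_neutral_right) (auto simp: supp_def)
        finally show ?thesis .
      qed
      \<comment> \<open>Negation preserves the equations, so the sign is free and is chosen to keep
        the total weight from dropping.\<close>
      define z where "z = (if sum y E \<ge> 0 then y else (\<lambda>e. - y e))"
      have z: "\<And>e. e \<notin> supp w \<Longrightarrow> z e = 0" "\<exists>e\<in>supp w. z e \<noteq> 0"
          "\<And>v. v \<in> V \<Longrightarrow> load w v = 1 \<Longrightarrow> load z v = 0" "sum z E \<ge> 0"
        using y loady by (auto simp: z_def load_def sum_negf)
      \<comment> \<open>Both kinds of constraint in one disjoint sum: nonnegativity of weights on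
        the left, slack of the loads on the right.\<close>
      let ?C = "supp w <+> V"
      let ?a = "case_sum w (\<lambda>v. 1 - load w v)" and ?b = "case_sum z (\<lambda>v. - load z v)"
      \<comment> \<open>The move must hit the boundary: if no weight decreases, some weight
        increases, and so does the load at every point of that edge.\<close>
      have "\<exists>c\<in>?C. ?b c < 0"
      proof (cases "\<exists>e\<in>supp w. z e < 0")
        case True
        then show ?thesis
          by force
      next
        case nonneg: False
        then obtain e where e: "e \<in> supp w" "z e > 0"
          using z(2) by force
        then obtain v where v: "v \<in> T e" "v \<in> V"
          using fin(3) by (fastforce simp: supp_def V_def)
        have z0: "z e \<ge> 0" for e
          using nonneg z(1)[of e] by fastforce
        have "z e \<le> load z v"
          unfolding load_def using e v z0 fin by (intro member_le_sum) (auto simp: supp_def)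
        then show ?thesis
          using e v by (intro bexI[of _ "Inr v"]) auto
      qed
      moreover have "0 \<le> ?a c" "?a c = 0 \<Longrightarrow> ?b c = 0" if "c \<in> ?C" for c
        using that pw z by (auto simp: packing_def supp_def load_def)
      moreover have "finite ?C"
        using finV finS by simp
      ultimately obtain t where t: "t > 0" "\<And>c. c \<in> ?C \<Longrightarrow> 0 \<le> ?a c + t * ?b c"
          "\<exists>c\<in>?C. ?a c > 0 \<and> ?a c + t * ?b c = 0"
        using affine_step_to_boundary[of ?C ?a ?b] by blast
      define u where "u = (\<lambda>e. w e + t * z e)"
      have loadu: "load u v = load w v + t * load z v" for v
        by (simp add: u_def load_def sum.distrib sum_distrib_left)
      have out: "load x v = 0" if "v \<notin> V" for x v
      proof -
        have "{e\<in>E. v \<in> T e} = {}"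
          using that by (auto simp: V_def)
        then show ?thesis
          by (simp only: load_def sum.empty)
      qed
      have "load u v \<le> 1" for v
        using t(2)[OF InrI[of v]] out[of v u] by (cases "v \<in> V") (auto simp: loadu algebra_simps)
      moreover have "u e \<ge> 0" if "e \<in> E" for e
        using t(2)[OF InlI[of e]] that z(1)[of e] pw
        by (cases "e \<in> supp w") (auto simp: u_def packing_def)
      ultimately have pu: "packing E T u"
        by (auto simp: packing_def load_def)
      have su: "supp u \<subseteq> supp w"
        using z(1) by (auto simp: supp_def u_def)
      have lu: "loose u \<subseteq> loose w"
        using z(3) by (auto simp: loose_def loadu)
      have "supp u \<noteq> supp w \<or> loose u \<noteq> loose w"
      proof -
        from t(3) obtain c where "c \<in> ?C" and c: "?a c > 0" "?a c + t * ?b c = 0"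
          by blast
        from \<open>c \<in> ?C\<close> show ?thesis
        proof
          fix e assume "e \<in> supp w" "c = Inl e"
          then show ?thesis
            using c by (auto simp: supp_def u_def)
        next
          fix v assume "v \<in> V" "c = Inr v"
          then have "v \<in> loose w" "v \<notin> loose u"
            using c by (auto simp: loose_def loadu)
          then show ?thesis
            by blast
        qed
      qed
      then have "card (supp u) + card (loose u) < card (supp w) + card (loose w)"
      proof
        assume "supp u \<noteq> supp w"
        then have "card (supp u) < card (supp w)"
          using su finS(1) by (intro psubset_card_mono) auto
        then show ?thesis
          using card_mono[OF finS(2) lu] by linarith
      next
        assume "loose u \<noteq> loose w"
        then have "card (loose u) < card (loose w)"
          using lu finS(2) by (intro psubset_card_mono) auto
        then show ?thesis
          using card_mono[OF finS(1) su] by linarith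
      qed
      from less.hyps[OF this pu] obtain u' where "packing E T u'" "sum u E \<le> sum u' E"
          "card (supp u') \<le> card {v\<in>V. load u' v = 1}"
        by blast
      moreover have "sum w E \<le> sum u E"
        using t(1) z(4) by (simp add: u_def sum.distrib flip: sum_distrib_left)
      ultimately show ?thesis
        by (meson order_trans)
    qed
  qed
  then show thesis
    using that by (auto simp: supp_def load_def V_def)
qed

lemma sum_swap_incidence:
  fixes w :: "'e \<Rightarrow> real"
  assumes "finite E" "finite A"
  shows "(\<Sum>v\<in>A. \<Sum>e\<in>{e\<in>E. v \<in> T e}. w e) = (\<Sum>e\<in>E. real (card (A \<inter> T e)) * w e)"
proof -
  have "(\<Sum>v\<in>A. \<Sum>e\<in>{e\<in>E. v \<in> T e}. w e) = (\<Sum>e\<in>E. \<Sum>v\<in>{v\<in>A. v \<in> T e}. w e)"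
    by (rule sum.swap_restrict[OF assms(2,1)])
  then show ?thesis
    by (simp add: Int_def)
qed

text \<open>If all weights were below 1/d, summing the loads of the saturated points would bound
  their number by \<open>d\<close> times the total weight, hence strictly below the size of the
  support. Strictness uses that a positive total makes the support nonempty.\<close>

lemma packing_vertex_heavy_edge:
  fixes T :: "'e \<Rightarrow> 'v set"
  assumes fin: "finite E" "\<And>e. e \<in> E \<Longrightarrow> finite (T e)" and rank: "\<And>e. e \<in> E \<Longrightarrow> card (T e) \<le> d"
    and "packing E T u" and "sum u E > 0"
    and tight: "card {e\<in>E. u e \<noteq> 0} \<le> card {v \<in> \<Union>(T ` E). (\<Sum>e\<in>{e\<in>E. v \<in> T e}. u e) = 1}"
  obtains e where "e \<in> E" "1 \<le> real d * u e"
proof (rule ccontr)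
  assume "\<not> thesis"
  then have small: "real d * u e < 1" if "e \<in> E" for e
    using that \<open>\<And>e. e \<in> E \<Longrightarrow> 1 \<le> real d * u e \<Longrightarrow> thesis\<close> by force
  let ?S = "{e\<in>E. u e \<noteq> 0}"
  let ?A = "{v \<in> \<Union>(T ` E). (\<Sum>e\<in>{e\<in>E. v \<in> T e}. u e) = 1}"
  have nn: "0 \<le> u e" if "e \<in> E" for e
    using that assms(4) by (auto simp: packing_def)
  have finA: "finite ?A"
    using fin by auto
  have "real (card ?S) \<le> real (card ?A)"
    using tight by simp
  also have "\<dots> = (\<Sum>v\<in>?A. \<Sum>e\<in>{e\<in>E. v \<in> T e}. u e)"
    by simp
  also have "\<dots> = (\<Sum>e\<in>E. real (card (?A \<inter> T e)) * u e)"
    by (rule sum_swap_incidence[OF fin(1) finA])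
  also have "\<dots> \<le> (\<Sum>e\<in>E. real d * u e)"
  proof (intro sum_mono mult_right_mono nn)
    fix e assume "e \<in> E"
    then have "card (?A \<inter> T e) \<le> card (T e)"
      using fin by (intro card_mono) auto
    then show "real (card (?A \<inter> T e)) \<le> real d"
      using rank[OF \<open>e \<in> E\<close>] by linarith
  qed
  also have "\<dots> = (\<Sum>e\<in>?S. real d * u e)"
    using fin by (intro sum.mono_neutral_right) auto
  also have "\<dots> < (\<Sum>e\<in>?S. 1)"
  proof (rule sum_strict_mono)
    show "?S \<noteq> {}"
      using \<open>sum u E > 0\<close> by (metis (mono_tags, lifting) empty_Collect_eq less_irrefl sum.neutral)
  qed (use fin small in auto)
  finally show False
    by simp
qed

text \<open>The bound is stated with denominators cleared. Each round picks a heavy edge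
  \<open>e\<close> and discards all edges meeting it; \<open>d\<close> times the discarded weight is
  at most the amount gained by adding \<open>e\<close> to the matching. What is left of
  \<open>u\<close> need not be a vertex for \<open>F\<close>, so the induction is over all
  \<open>w\<close> and reduces anew in each round.\<close>

theorem furedi_matching:
  fixes T :: "'e \<Rightarrow> 'v set"
  assumes "d \<ge> 1" and fin: "finite E" and finT: "\<And>e. e \<in> E \<Longrightarrow> finite (T e)"
    and ne: "\<And>e. e \<in> E \<Longrightarrow> T e \<noteq> {}" and rank: "\<And>e. e \<in> E \<Longrightarrow> card (T e) \<le> d"
    and "packing E T w"
  obtains M where "M \<subseteq> E" "pairwise (\<lambda>e f. disjnt (T e) (T f)) M"
    "real d * sum w E \<le> (real d ^ 2 - real d + 1) * real (card M)"
proof -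
  have "\<exists>M\<subseteq>E. pairwise (\<lambda>e f. disjnt (T e) (T f)) M \<and>
      real d * sum w E \<le> (real d ^ 2 - real d + 1) * real (card M)"
    using fin finT ne rank \<open>packing E T w\<close>
  proof (induction E arbitrary: w rule: finite_psubset_induct)
    case (psubset E)
    obtain u where u: "packing E T u" "sum w E \<le> sum u E"
      "card {e\<in>E. u e \<noteq> 0} \<le> card {v \<in> \<Union>(T ` E). (\<Sum>e\<in>{e\<in>E. v \<in> T e}. u e) = 1}"
      by (rule packing_vertex_reduction[of E T w]) (use psubset in auto)
    have nn: "0 \<le> u e" if "e \<in> E" for e
      using that u by (auto simp: packing_def)
    show ?case
    proof (cases "sum u E > 0")
      case False
      then have "real d * sum w E \<le> 0"
        using u(2) by (simp add: mult_nonneg_nonpos)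
      then show ?thesis
        by (intro exI[of _ "{}"]) auto
    next
      case True
      obtain e where e: "e \<in> E" "1 \<le> real d * u e"
        by (rule packing_vertex_heavy_edge[OF _ _ _ u(1) True u(3), of d]) (use psubset in auto)
      define F where "F = {f\<in>E. T e \<inter> T f = {}}"
      have F: "F \<subset> E" "finite F"
        using e psubset.prems(2) psubset.hyps by (auto simp: F_def)
      have "packing F T u"
        using packing_subset[OF u(1)] F psubset.hyps by auto
      then have "\<exists>M\<subseteq>F. pairwise (\<lambda>e f. disjnt (T e) (T f)) M \<and>
          real d * sum u F \<le> (real d ^ 2 - real d + 1) * real (card M)"
        using psubset.prems F(1) by (intro psubset.IH) auto
      then obtain M where M: "M \<subseteq> F" "pairwise (\<lambda>e f. disjnt (T e) (T f)) M"
        "real d * sum u F \<le> (real d ^ 2 - real d + 1) * real (card M)"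
        by blast
      have eM: "e \<notin> M" "finite M"
        using M(1) F finite_subset psubset.prems(2)[OF e(1)] by (auto simp: F_def)
      have "insert e M \<subseteq> E"
        using M(1) e by (auto simp: F_def)
      moreover have "pairwise (\<lambda>e f. disjnt (T e) (T f)) (insert e M)"
        using M(1,2) by (auto simp: pairwise_insert F_def disjnt_def)
      moreover have "real d * sum w E \<le> (real d ^ 2 - real d + 1) * real (card (insert e M))"
      proof -
        \<comment> \<open>Every edge meeting \<open>T e\<close> is counted in the loads of \<open>T e\<close>, and \<open>e\<close> itself \<open>card (T e)\<close> times.\<close>
        have "sum u (E - F) + (real (card (T e)) - 1) * u e
            = (\<Sum>f\<in>E - F. u f + (if f = e then (real (card (T e)) - 1) * u e else 0))"
          using e psubset.prems(2) psubset.hyps by (auto simp: sum.distrib F_def)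
        also have "\<dots> \<le> (\<Sum>f\<in>E - F. real (card (T e \<inter> T f)) * u f)"
        proof (rule sum_mono)
          fix f assume f: "f \<in> E - F"
          then have "T e \<inter> T f \<noteq> {}" "finite (T e \<inter> T f)"
            using psubset.prems(1) by (auto simp: F_def)
          then have "1 \<le> real (card (T e \<inter> T f))"
            using card_gt_0_iff[of "T e \<inter> T f"] by linarith
          then have "u f \<le> real (card (T e \<inter> T f)) * u f"
            using mult_right_mono[of 1 _ "u f"] nn f by simp
          then show "u f + (if f = e then (real (card (T e)) - 1) * u e else 0)
              \<le> real (card (T e \<inter> T f)) * u f"
            by (auto simp: algebra_simps)
        qed
        also have "\<dots> \<le> (\<Sum>f\<in>E. real (card (T e \<inter> T f)) * u f)"
          using psubset.hyps nn by (intro sum_mono2) auto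
        also have "\<dots> = (\<Sum>v\<in>T e. \<Sum>f\<in>{f\<in>E. v \<in> T f}. u f)"
          using psubset.hyps psubset.prems(1)[OF e(1)] by (simp add: sum_swap_incidence)
        also have "\<dots> \<le> (\<Sum>v\<in>T e. 1)"
          using u(1) by (intro sum_mono) (auto simp: packing_def)
        finally have A: "sum u (E - F) \<le> real (card (T e)) * (1 - u e) + u e"
          by (simp add: algebra_simps)
        \<comment> \<open>A point of \<open>e\<close> shows that \<open>1 - u e\<close> is
          nonnegative, so that \<open>card (T e)\<close> can be replaced by the upper bound
          \<open>d\<close>.\<close>
        obtain v where "v \<in> T e"
          using psubset.prems(2) e by blast
        then have "u e \<le> (\<Sum>f\<in>{f\<in>E. v \<in> T f}. u f)"
          using e psubset.hyps nn by (intro member_le_sum) auto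
        then have "u e \<le> 1"
          using u(1) unfolding packing_def by (meson order_trans)
        then have "real (card (T e)) * (1 - u e) \<le> real d * (1 - u e)"
          using psubset.prems(3)[OF e(1)] by (intro mult_right_mono) auto
        then have "sum u (E - F) \<le> real d - (real d - 1) * u e"
          using A by (simp add: algebra_simps)
        then have "real d * sum u (E - F) \<le> real d * (real d - (real d - 1) * u e)"
          by (intro mult_left_mono) auto
        also have "\<dots> = real d ^ 2 - (real d - 1) * (real d * u e)"
          by (simp add: algebra_simps power2_eq_square)
        \<comment> \<open>Here the heaviness of \<open>e\<close> enters.\<close>
        also have "\<dots> \<le> real d ^ 2 - (real d - 1) * 1"
          using e \<open>d \<ge> 1\<close> by (intro diff_mono mult_left_mono) auto
        finally have B: "real d * sum u (E - F) \<le> real d ^ 2 - real d + 1"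
          by simp
        have "real d * sum w E \<le> real d * sum u E"
          using u(2) by (simp add: mult_left_mono)
        also have "\<dots> = real d * sum u (E - F) + real d * sum u F"
          using sum.subset_diff[of F E u] F psubset.hyps by (auto simp: algebra_simps)
        also have "\<dots> \<le> (real d ^ 2 - real d + 1) * real (card (insert e M))"
          using B M(3) eM by (simp add: algebra_simps)
        finally show ?thesis .
      qed
      ultimately show ?thesis
        by blast
    qed
  qed
  then show thesis
    using that by blast
qed

section \<open>Balanced cuts\<close>

text \<open>Stick breaking: \<open>t i\<close> is the fraction cut off the rest of the interval at
  step \<open>i\<close>. Increasing sequences of cuts are thus parametrised by a cube, as
  Poincare-Miranda requires.\<close>

primrec stick_cut :: "real \<Rightarrow> real \<Rightarrow> (nat \<Rightarrow> real) \<Rightarrow> nat \<Rightarrow> real" where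
  "stick_cut lo hi t 0 = lo"
| "stick_cut lo hi t (Suc i) = stick_cut lo hi t i + t i * (hi - stick_cut lo hi t i)"

lemma stick_cut_bounds:
  assumes "lo \<le> hi" "t \<in> UNIV \<rightarrow> {0..1}"
  shows "lo \<le> stick_cut lo hi t i \<and> stick_cut lo hi t i \<le> hi"
proof (induction i)
  case (Suc i)
  have t: "0 \<le> t i" "t i \<le> 1"
    using assms(2) by auto
  then have "t i * (hi - stick_cut lo hi t i) \<le> 1 * (hi - stick_cut lo hi t i)"
    using Suc by (intro mult_right_mono) auto
  moreover have "0 \<le> t i * (hi - stick_cut lo hi t i)"
    using Suc t by simp
  ultimately show ?case
    using Suc by simp
qed (use assms in auto)

lemma stick_cut_step:
  assumes "lo \<le> hi" "t \<in> UNIV \<rightarrow> {0..1}"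
  shows "stick_cut lo hi t i \<le> stick_cut lo hi t (Suc i)"
proof -
  have "0 \<le> t i"
    using assms(2) by auto
  then show ?thesis
    using stick_cut_bounds[OF assms, of i] by simp
qed

lemma stick_cut_eq_hi:
  assumes "t i = 1" "i < j"
  shows "stick_cut lo hi t j = hi"
  using assms(2)
proof (induction j)
  case (Suc j)
  then show ?case
    using assms(1) by (cases "i = j") auto
qed simp

lemma continuous_on_stick_cut:
  assumes "\<And>i. continuous_on S (\<lambda>x. t x i)"
  shows "continuous_on S (\<lambda>x. stick_cut lo hi (t x) j)"
  by (induction j) (auto intro!: continuous_intros assms)

lemma subdivision_index:
  fixes p :: "nat \<Rightarrow> 'a::linorder"
  assumes "p 0 \<le> v" "v \<le> p (Suc n)"
  obtains i where "i \<le> n" "p i \<le> v" "v \<le> p (Suc i)"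
  using assms
proof (induction n arbitrary: thesis)
  case (Suc n)
  show ?case
  proof (cases "v \<le> p (Suc n)")
    case True
    then show ?thesis
      using Suc.IH[of thesis] Suc.prems(1,2) le_SucI by blast
  next
    case False
    then show ?thesis
      using Suc.prems(1)[of "Suc n"] Suc.prems(3) by simp
  qed
qed auto

text \<open>Descending from \<open>n\<close>: each value is the average of the later ones, which
  already agree.\<close>

lemma equal_if_tail_averages:
  fixes F :: "nat \<Rightarrow> real"
  assumes "\<And>i. i < n \<Longrightarrow> real (n - i) * F i = (\<Sum>j\<in>{i<..n}. F j)" and "i \<le> n"
  shows "F i = F n"
  using assms(2)
proof (induction "n - i" arbitrary: i rule: less_induct)
  case less
  show ?case
  proof (cases "i = n")
    case False
    then have "i < n"
      using less.prems by simp
    have "(\<Sum>j\<in>{i<..n}. F j) = (\<Sum>j\<in>{i<..n}. F n)"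
      using \<open>i < n\<close> by (intro sum.cong refl less.hyps) auto
    then have "real (n - i) * F i = real (n - i) * F n"
      using assms(1)[OF \<open>i < n\<close>] by simp
    then show ?thesis
      using \<open>i < n\<close> by simp
  qed simp
qed

text \<open>The finite set \<open>R h\<close> stands in for \<open>h\<close> when incidence with a
  piece is tested, so that the incidence pattern is governed by finitely many comparisons with cuts.
  As \<open>R h\<close> lies in \<open>h\<close>, the pattern can change only where a cut hits
  \<open>h\<close>, and there the weight of \<open>h\<close> vanishes.\<close>

theorem balanced_cut:
  fixes H :: "real set set" and R :: "real set \<Rightarrow> real set"
  assumes finH: "finite H"
    and H: "\<And>h. h \<in> H \<Longrightarrow> closed h" "\<And>h. h \<in> H \<Longrightarrow> h \<noteq> {}" "\<And>h. h \<in> H \<Longrightarrow> h \<subseteq> {lo<..<hi}"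
    and R: "\<And>h. h \<in> H \<Longrightarrow> finite (R h)" "\<And>h. h \<in> H \<Longrightarrow> R h \<noteq> {}" "\<And>h. h \<in> H \<Longrightarrow> R h \<subseteq> h"
    and uncovered: "\<And>C. finite C \<Longrightarrow> card C \<le> n \<Longrightarrow> \<exists>h\<in>H. C \<inter> h = {}"
  obtains p :: "nat \<Rightarrow> real" and w :: "real set \<Rightarrow> real"
  where "p 0 = lo" "p (Suc n) = hi" "mono p" "\<forall>h. 0 \<le> w h"
    "\<forall>h\<in>H. w h > 0 \<longrightarrow> (\<forall>i\<le>Suc n. p i \<notin> h)"
    "\<forall>i\<le>n. (\<Sum>h\<in>{h\<in>H. R h \<inter> {p i..p (Suc i)} \<noteq> {}}. w h) = 1"
proof -
  have "lo \<le> hi"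
  proof -
    obtain h where "h \<in> H"
      using uncovered[of "{}"] by auto
    then obtain v where "v \<in> {lo<..<hi}"
      using H(2,3) by blast
    then show ?thesis
      by simp
  qed
  \<comment> \<open>The fraction 1 at index \<open>n\<close> forces the cut with index
    \<open>Suc n\<close> to be \<open>hi\<close>, which leaves exactly \<open>n\<close> free
    parameters.\<close>
  define ext where "ext = (\<lambda>t i. if i < n then t i else 1 :: real)"
  define P where "P = (\<lambda>t. stick_cut lo hi (ext t))"
  define G where "G = (\<lambda>t h. \<Prod>j\<le>Suc n. infdist (P t j) h)"
  define meets where "meets = (\<lambda>t h i. R h \<inter> {P t i..P t (Suc i)} \<noteq> {})"
  define F where "F = (\<lambda>t i. \<Sum>h\<in>H. if meets t h i then G t h else 0)"
  have ext: "ext t \<in> UNIV \<rightarrow> {0..1}" if "t \<in> UNIV \<rightarrow> {0..1}" for t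
    using that by (auto simp: ext_def)
  have Pstep: "P t i \<le> P t (Suc i)" if "t \<in> UNIV \<rightarrow> {0..1}" for t i
    unfolding P_def by (rule stick_cut_step[OF \<open>lo \<le> hi\<close> ext[OF that]])
  have P0: "P t 0 = lo" for t
    by (simp add: P_def)
  have Pn: "P t (Suc n) = hi" for t
    unfolding P_def by (rule stick_cut_eq_hi[of _ n]) (auto simp: ext_def)
  have G_nonneg: "0 \<le> G t h" for t h
    unfolding G_def by (intro prod_nonneg) (simp add: infdist_nonneg)
  have G0: "G t h = 0 \<longleftrightarrow> (\<exists>j\<le>Suc n. P t j \<in> h)" if "h \<in> H" for t h
    using in_closed_iff_infdist_zero[OF H(1)[OF that] H(2)[OF that]] by (auto simp: G_def simp del: prod.atMost_Suc)
  have contP: "continuous_on UNIV (\<lambda>t. P t j)" for j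
    unfolding P_def
  proof (rule continuous_on_stick_cut)
    fix i show "continuous_on UNIV (\<lambda>t. ext t i)"
      by (cases "i < n") (auto simp: ext_def)
  qed
  have contG: "continuous_on S (\<lambda>t. G t h)" for S h
    unfolding G_def by (intro continuous_intros continuous_on_subset[OF contP]) auto
  have "continuous_on UNIV (\<lambda>t. if meets t h i then G t h else 0)" if "h \<in> H" "i \<le> n" for h i
  proof -
    \<comment> \<open>The pattern of incidences changes only where a cut hits \<open>h\<close>, and there \<open>G\<close> vanishes.\<close>
    let ?A = "\<Union>r\<in>R h. {t. P t i \<le> r} \<inter> {t. r \<le> P t (Suc i)}"
    let ?B = "\<Inter>r\<in>R h. {t. r \<le> P t i} \<union> {t. P t (Suc i) \<le> r}"
    have cl: "closed {t. P t j \<le> r}" "closed {t. r \<le> P t j}" for j r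
      using contP by (auto intro!: closed_Collect_le)
    have A: "meets t h i \<longleftrightarrow> t \<in> ?A" for t
      by (auto simp: meets_def)
    have "t \<in> ?B" if "\<not> meets t h i" for t
      using that by (auto simp: A)
    then have un: "?A \<union> ?B = UNIV"
      using A by auto
    have "continuous_on (?A \<union> ?B) (\<lambda>t. if meets t h i then G t h else 0)"
    proof (rule continuous_on_cases)
      show "closed ?A" "closed ?B"
        using R(1)[OF \<open>h \<in> H\<close>] cl by (auto intro!: closed_UN closed_INT closed_Int closed_Un)
      have "G t h = 0" if "t \<in> ?B" "meets t h i" for t
      proof -
        obtain r where r: "r \<in> R h" "P t i \<le> r" "r \<le> P t (Suc i)"
          using \<open>meets t h i\<close> by (auto simp: meets_def)
        moreover have "r \<le> P t i \<or> P t (Suc i) \<le> r"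
          using r(1) \<open>t \<in> ?B\<close> by auto
        ultimately have "P t i \<in> h \<or> P t (Suc i) \<in> h"
          using R(3)[OF \<open>h \<in> H\<close>] by force
        then show ?thesis
          using G0[OF \<open>h \<in> H\<close>] \<open>i \<le> n\<close> by (meson Suc_le_mono le_SucI)
      qed
      then show "\<forall>t. t \<in> ?A \<and> \<not> meets t h i \<or> t \<in> ?B \<and> meets t h i \<longrightarrow> G t h = 0"
        using A by blast
    qed (auto intro: contG)
    then show ?thesis
      unfolding un .
  qed
  then have contF: "continuous_on S (\<lambda>t. F t i)" if "i \<le> n" for i S
    unfolding F_def using that
    by (intro continuous_on_sum) (auto intro: continuous_on_subset)
  have F_nonneg: "0 \<le> F t i" for t i
    unfolding F_def by (intro sum_nonneg) (auto simp: G_nonneg)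
  have F_degenerate: "F t i = 0" if "i \<le> n" "P t i = P t (Suc i)" for t i
    unfolding F_def
  proof (rule sum.neutral, rule ballI)
    fix h assume h: "h \<in> H"
    have "P t i \<in> h" if "meets t h i"
      using that R(3)[OF h] \<open>P t i = P t (Suc i)\<close> by (auto simp: meets_def)
    then show "(if meets t h i then G t h else 0) = 0"
      using G0[OF h, of t] \<open>i \<le> n\<close> by auto
  qed
  \<comment> \<open>Comparing \<open>F t i\<close> with the average over the later pieces gives the
    boundary signs: fraction 0 at \<open>i\<close> degenerates piece \<open>i\<close>, while
    fraction 1 degenerates all later pieces.\<close>
  define g where "g = (\<lambda>i t. real (n - i) * F t i - (\<Sum>j\<in>{i<..n}. F t j))"
  obtain t where t: "t \<in> UNIV \<rightarrow> {0..1}" and gt: "\<And>i. i < n \<Longrightarrow> g i t = 0"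
  proof (rule poincare_miranda[of n g])
    show "continuous_on (UNIV \<rightarrow> {0..1}) (g i)" if "i < n" for i
      unfolding g_def using that by (intro continuous_intros contF) auto
    show "g i x \<le> 0" if "i < n" "x \<in> UNIV \<rightarrow> {0..1}" "x i = 0" for i x
    proof -
      have "F x i = 0"
        using that by (intro F_degenerate) (auto simp: P_def ext_def)
      then show ?thesis
        using F_nonneg by (auto simp: g_def intro: sum_nonneg)
    qed
    show "0 \<le> g i x" if "i < n" "x \<in> UNIV \<rightarrow> {0..1}" "x i = 1" for i x
    proof -
      have "P x j = hi" if "i < j" for j
        unfolding P_def using that \<open>i < n\<close> \<open>x i = 1\<close> by (intro stick_cut_eq_hi[of _ i]) (auto simp: ext_def)
      then have "F x j = 0" if "j \<in> {i<..n}" for j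
        using that by (intro F_degenerate) auto
      then have "(\<Sum>j\<in>{i<..n}. F x j) = 0"
        by (intro sum.neutral) blast
      then show ?thesis
        using F_nonneg by (simp add: g_def)
    qed
  qed blast
  have Feq: "F t i = F t n" if "i \<le> n" for i
    using gt that by (intro equal_if_tail_averages[of n "F t"]) (auto simp: g_def)
  \<comment> \<open>The \<open>n\<close> inner cuts miss some edge \<open>h\<close>, and
    \<open>lo\<close> and \<open>hi\<close> lie outside it, so \<open>G t h\<close> is positive. A
    representative of \<open>h\<close> lies in some piece, and all pieces have equal
    \<open>F\<close>.\<close>
  have "F t n > 0"
  proof -
    have "card (P t ` {1..n}) \<le> n"
      using card_image_le[of "{1..n}" "P t"] by simp
    then obtain h where h: "h \<in> H" "P t ` {1..n} \<inter> h = {}"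
      using uncovered[of "P t ` {1..n}"] by auto
    have "P t j \<notin> h" if "j \<le> Suc n" for j
    proof (cases "j = 0 \<or> j = Suc n")
      case True
      then show ?thesis
        using H(3)[OF h(1)] P0 Pn by auto
    next
      case False
      then have "j \<in> {1..n}"
        using that by auto
      then show ?thesis
        using h(2) by blast
    qed
    then have Gh: "G t h > 0"
      using G0[OF h(1), of t] G_nonneg[of t h] by force
    obtain r where r: "r \<in> R h"
      using R(2)[OF h(1)] by blast
    then have "r \<in> {lo<..<hi}"
      using R(3) H(3) h(1) by blast
    then obtain i where i: "i \<le> n" "P t i \<le> r" "r \<le> P t (Suc i)"
      using subdivision_index[of "P t" r n] P0[of t] Pn[of t] by auto
    then have "meets t h i"
      using r by (auto simp: meets_def)
    then have "G t h \<le> F t i"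
      unfolding F_def
      using member_le_sum[OF h(1), of "\<lambda>h. if meets t h i then G t h else 0"] finH G_nonneg by auto
    then show ?thesis
      using Gh Feq[OF i(1)] by simp
  qed
  define w where "w = (\<lambda>h. G t h / F t n)"
  show thesis
  proof (rule that[of "P t" w])
    show "\<forall>h. 0 \<le> w h"
      using G_nonneg \<open>F t n > 0\<close> by (simp add: w_def)
    show "\<forall>h\<in>H. w h > 0 \<longrightarrow> (\<forall>i\<le>Suc n. P t i \<notin> h)"
    proof (intro ballI impI allI)
      fix h i assume "h \<in> H" "w h > 0" "i \<le> Suc n"
      then show "P t i \<notin> h"
        using G0[of h t] by (auto simp: w_def)
    qed
    have "(\<Sum>h\<in>{h\<in>H. R h \<inter> {P t i..P t (Suc i)} \<noteq> {}}. w h) = 1" if "i \<le> n" for i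
    proof -
      have "(\<Sum>h\<in>{h\<in>H. meets t h i}. w h) = F t i / F t n"
        using finH by (simp add: w_def F_def sum.If_cases Int_def flip: sum_divide_distrib)
      then show ?thesis
        using Feq[OF that] \<open>F t n > 0\<close> by (simp add: meets_def)
    qed
    then show "\<forall>i\<le>n. (\<Sum>h\<in>{h\<in>H. R h \<inter> {P t i..P t (Suc i)} \<noteq> {}}. w h) = 1"
      by blast
  qed (auto simp: P0 Pn mono_iff_le_Suc Pstep[OF t])
qed

section \<open>Families of d-intervals\<close>

lemma d_interval_compact:
  assumes "d_interval d h"
  shows "compact h"
  using assms by (auto simp: d_interval_def intro!: compact_UN)

lemma d_interval_nonempty:
  assumes "d_interval d h"
  shows "h \<noteq> {}"
proof -
  obtain k :: nat and a b where "1 \<le> k" "\<forall>i<k. a i \<le> b i" and h: "h = (\<Union>i<k. {a i..b i})"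
    using assms unfolding d_interval_def by blast
  then have "a 0 \<in> h"
    by (auto intro!: bexI[of _ 0])
  then show ?thesis
    by blast
qed

text \<open>Left endpoints of the components serve. A cut outside \<open>h\<close> cannot separate
  \<open>v\<close> from its \<open>r\<close>; so when the left cut of a piece avoids
  \<open>h\<close>, the piece contains a representative as soon as it meets
  \<open>h\<close>.\<close>

lemma d_interval_representatives:
  assumes "d_interval d h"
  obtains R where "finite R" "R \<subseteq> h" "card R \<le> d" "\<And>v. v \<in> h \<Longrightarrow> \<exists>r\<in>R. r \<le> v \<and> {r..v} \<subseteq> h"
proof -
  obtain k :: nat and a b where "k \<le> d" and ab: "\<forall>i<k. a i \<le> b i" and h: "h = (\<Union>i<k. {a i..b i})"
    using assms unfolding d_interval_def by blast
  show thesis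
  proof
    show "card (a ` {..<k}) \<le> d"
      using card_image_le[of "{..<k}" a] \<open>k \<le> d\<close> by simp
    show "a ` {..<k} \<subseteq> h"
      using ab by (auto simp: h)
    show "\<exists>r\<in>a ` {..<k}. r \<le> v \<and> {r..v} \<subseteq> h" if "v \<in> h" for v
    proof -
      obtain i where "i < k" "a i \<le> v" "v \<le> b i"
        using \<open>v \<in> h\<close> by (auto simp: h)
      then show ?thesis
        by (intro bexI[of _ "a i"]) (auto simp: h intro!: bexI[of _ i])
    qed
  qed simp
qed

lemma card_matching_le_nu:
  assumes "finite H" "matching H M"
  shows "card M \<le> nu H"
proof -
  have "{M. matching H M} \<subseteq> Pow H"
    by (auto simp: matching_def)
  then have "finite {M. matching H M}"
    using assms(1) by (simp add: finite_subset)
  then show ?thesis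
    using assms(2) by (auto simp: nu_def)
qed

text \<open>The real \<open>Sup\<close> is an upper bound only for a bounded set. Any point of
  \<open>h\<close> gives \<open>f h\<close> at most 1, so all totals are at most
  \<open>card H\<close>.\<close>

lemma sum_fractional_matching_le_nu_star:
  assumes "finite H" "\<And>h. h \<in> H \<Longrightarrow> h \<noteq> {}" "fractional_matching H f"
  shows "sum f H \<le> nu_star H"
  unfolding nu_star_def
proof (rule cSup_upper)
  show "sum f H \<in> {sum f H |f. fractional_matching H f}"
    using assms by blast
  have "f h \<le> 1" if "fractional_matching H f" "h \<in> H" for f h
  proof -
    obtain v where "v \<in> h"
      using assms(2)[OF \<open>h \<in> H\<close>] by blast
    then have "f h \<le> (\<Sum>h\<in>{h\<in>H. v \<in> h}. f h)"
      using that assms(1) by (intro member_le_sum) (auto simp: fractional_matching_def)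
    then show ?thesis
      using that unfolding fractional_matching_def by (meson order_trans)
  qed
  then have "sum f H \<le> real (card H)" if "fractional_matching H f" for f
    using that sum_bounded_above[of H f 1] by simp
  then show "bdd_above {sum f H |f. fractional_matching H f}"
    by (intro bdd_aboveI) auto
qed

theorem theorem6p2:
  fixes d :: nat and H :: "real set set"
  assumes "d \<ge> 1" and "finite H" and "\<forall>h\<in>H. d_interval d h"
  shows "tau H \<le> (d^2 - d + 1) * nu H \<and> real (tau H) \<le> real d * nu_star H"
proof (cases "tau H")
  case 0
  have "fractional_matching H (\<lambda>_. 0)"
    by (simp add: fractional_matching_def)
  then have "0 \<le> nu_star H"
    using sum_fractional_matching_le_nu_star[of H "\<lambda>_. 0"] assms d_interval_nonempty by auto
  then show ?thesis
    using 0 by simp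
next
  case (Suc n)
  note finH = \<open>finite H\<close>
  have compH: "compact h" and neH: "h \<noteq> {}" if "h \<in> H" for h
    using that assms(3) d_interval_compact d_interval_nonempty by blast+
  obtain B where B: "\<And>v. v \<in> \<Union>H \<Longrightarrow> \<bar>v\<bar> \<le> B"
    using compact_imp_bounded[OF compact_Union[OF finH compH]] unfolding bounded_real by blast
  have "\<exists>R. finite R \<and> R \<subseteq> h \<and> card R \<le> d \<and> (\<forall>v\<in>h. \<exists>r\<in>R. r \<le> v \<and> {r..v} \<subseteq> h)"
    if "h \<in> H" for h
    by (rule d_interval_representatives[OF bspec[OF assms(3) that]]) blast
  then have "\<forall>h\<in>H. \<exists>R. finite R \<and> R \<subseteq> h \<and> card R \<le> d \<and>
      (\<forall>v\<in>h. \<exists>r\<in>R. r \<le> v \<and> {r..v} \<subseteq> h)"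
    by blast
  from bchoice[OF this] obtain R where R_props: "\<forall>h\<in>H. finite (R h) \<and> R h \<subseteq> h \<and> card (R h) \<le> d \<and>
      (\<forall>v\<in>h. \<exists>r\<in>R h. r \<le> v \<and> {r..v} \<subseteq> h)" ..
  have R: "finite (R h)" "R h \<subseteq> h" "card (R h) \<le> d"
      "\<And>v. v \<in> h \<Longrightarrow> \<exists>r\<in>R h. r \<le> v \<and> {r..v} \<subseteq> h" if "h \<in> H" for h
    using bspec[OF R_props that] by simp_all
  have RN: "R h \<noteq> {}" if "h \<in> H" for h
    using R(4)[OF that] neH[OF that] by fastforce
  have unc: "\<exists>h\<in>H. C \<inter> h = {}" if "finite C" "card C \<le> n" for C
  proof (rule ccontr)
    assume "\<not> ?thesis"
    then have "cover H C"
      using that by (auto simp: cover_def)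
    then have "tau H \<le> card C"
      unfolding tau_def by (intro Least_le) blast
    then show False
      using Suc that by simp
  qed
  \<comment> \<open>The margin 1 keeps both end cuts strictly outside every edge.\<close>
  have inside: "h \<subseteq> {- B - 1<..<B + 1}" if "h \<in> H" for h
    using B that by (force simp: abs_le_iff)
  obtain p and w :: "real set \<Rightarrow> real" where p0: "p 0 = - B - 1" and pn: "p (Suc n) = B + 1" and "mono p"
    and w_props: "\<forall>h. 0 \<le> w h" "\<forall>h\<in>H. w h > 0 \<longrightarrow> (\<forall>i\<le>Suc n. p i \<notin> h)"
      "\<forall>i\<le>n. (\<Sum>h\<in>{h\<in>H. R h \<inter> {p i..p (Suc i)} \<noteq> {}}. w h) = 1"
    by (rule balanced_cut[OF finH compact_imp_closed[OF compH] neH inside R(1) RN R(2) unc])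
      (assumption | rule that)+
  have w0: "0 \<le> w h" for h
    using w_props(1) by blast
  have avoid: "p i \<notin> h" if "h \<in> H" "w h > 0" "i \<le> Suc n" for h i
    using w_props(2) that by blast
  have bal: "(\<Sum>h\<in>{h\<in>H. R h \<inter> {p i..p (Suc i)} \<noteq> {}}. w h) = 1" if "i \<le> n" for i
    using w_props(3) that by blast
  \<comment> \<open>Edges of positive weight are avoided by all cuts; \<open>T h\<close> is the
    trace of \<open>h\<close> on the pieces numbered from 0 to \<open>n\<close>.\<close>
  define E where "E = {h\<in>H. w h > 0}"
  define T where "T = (\<lambda>h. {i. i \<le> n \<and> R h \<inter> {p i..p (Suc i)} \<noteq> {}})"
  have EH: "E \<subseteq> H" "finite E"
    using finH by (auto simp: E_def)
  have sumE: "(\<Sum>h\<in>{h\<in>E. Q h}. w h) = (\<Sum>h\<in>{h\<in>H. Q h}. w h)" for Q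
    using finH w0 by (intro sum.mono_neutral_left) (auto simp: E_def less_le)
  have inT: "i \<in> T h" if h: "h \<in> E" and v: "v \<in> h" "i \<le> n" "p i \<le> v" "v \<le> p (Suc i)" for h v i
  proof -
    obtain r where r: "r \<in> R h" "r \<le> v" "{r..v} \<subseteq> h"
      using R(4) h v(1) EH by blast
    have "p i \<notin> h"
      using avoid h \<open>i \<le> n\<close> by (auto simp: E_def)
    then have "p i \<le> r"
      using r v by (meson atLeastAtMost_iff le_cases subsetD)
    then show ?thesis
      using r v by (auto simp: T_def)
  qed
  have finT: "finite (T h)" for h
    by (simp add: T_def)
  have monop: "p i \<le> p j" if "i \<le> j" for i j
    using \<open>mono p\<close> that by (rule monoD)
  have cardT: "card (T h) \<le> d" if h: "h \<in> E" for h
  proof -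
    have "\<forall>i\<in>T h. \<exists>r. r \<in> R h \<and> p i \<le> r \<and> r \<le> p (Suc i)"
      by (auto simp: T_def)
    then obtain \<rho> where \<rho>: "\<And>i. i \<in> T h \<Longrightarrow> \<rho> i \<in> R h \<and> p i \<le> \<rho> i \<and> \<rho> i \<le> p (Suc i)"
      by metis
    \<comment> \<open>Different pieces can share only a cut point, and no cut lies in
      \<open>h\<close>; so different pieces use different representatives.\<close>
    have neq: "\<rho> i \<noteq> \<rho> j" if "i \<in> T h" "j \<in> T h" "i < j" for i j
    proof
      assume "\<rho> i = \<rho> j"
      then have "\<rho> j = p j"
        using \<rho>[OF that(1)] \<rho>[OF that(2)] monop[of "Suc i" j] that(3) by simp
      then have "p j \<in> h"
        using \<rho>[OF that(2)] R(2) h EH by auto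
      then show False
        using avoid[of h j] h that(2) by (auto simp: E_def T_def)
    qed
    then have "inj_on \<rho> (T h)"
      by (intro inj_onI) (metis linorder_less_linear)
    then have "card (T h) \<le> card (R h)"
      using \<rho> R(1) h EH by (intro card_inj_on_le) auto
    then show ?thesis
      using R(3) h EH by (meson order_trans subsetD)
  qed
  have load: "(\<Sum>h\<in>{h\<in>E. i \<in> T h}. w h) = (if i \<le> n then 1 else 0)" for i
  proof (cases "i \<le> n")
    case True
    have "(\<Sum>h\<in>{h\<in>E. i \<in> T h}. w h) = (\<Sum>h\<in>{h\<in>H. R h \<inter> {p i..p (Suc i)} \<noteq> {}}. w h)"
      using True by (simp add: T_def sumE)
    then show ?thesis
      using bal True by simp
  qed (simp add: T_def)
  have located: "\<exists>i\<le>n. p i \<le> v \<and> v \<le> p (Suc i)" if "v \<in> h" "h \<in> H" for v h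
  proof -
    have "p 0 \<le> v" "v \<le> p (Suc n)"
      using inside[OF that(2)] that(1) p0 pn by auto
    then show ?thesis
      by (rule subdivision_index) blast
  qed
  have neT: "T h \<noteq> {}" if "h \<in> E" for h
    using neH[of h] located inT that EH by blast
  have pack: "packing E T w"
    using w0 load by (simp add: packing_def)
  have total: "real (Suc n) \<le> real d * sum w E"
  proof -
    have "real (Suc n) = (\<Sum>i\<le>n. \<Sum>h\<in>{h\<in>E. i \<in> T h}. w h)"
      by (simp add: load)
    also have "\<dots> = (\<Sum>h\<in>E. real (card ({..n} \<inter> T h)) * w h)"
      by (rule sum_swap_incidence[OF EH(2)]) simp
    also have "\<dots> \<le> (\<Sum>h\<in>E. real d * w h)"
    proof (intro sum_mono mult_right_mono w0)
      fix h assume "h \<in> E"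
      have "card ({..n} \<inter> T h) \<le> card (T h)"
        by (intro card_mono finT) auto
      then show "real (card ({..n} \<inter> T h)) \<le> real d"
        using cardT[OF \<open>h \<in> E\<close>] by linarith
    qed
    finally show ?thesis
      by (simp add: sum_distrib_left)
  qed
  have "tau H \<le> (d^2 - d + 1) * nu H"
  proof -
    obtain M where M: "M \<subseteq> E" "pairwise (\<lambda>e f. disjnt (T e) (T f)) M"
        "real d * sum w E \<le> (real d ^ 2 - real d + 1) * real (card M)"
      by (rule furedi_matching[OF assms(1) EH(2) finT neT cardT pack])
    \<comment> \<open>A common point lies in some piece, and that piece would belong to both
      traces.\<close>
    have "disjnt e f" if ef: "e \<in> M" "f \<in> M" "e \<noteq> f" for e f
    proof (rule ccontr)
      assume "\<not> disjnt e f"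
      then obtain v where v: "v \<in> e" "v \<in> f"
        by (auto simp: disjnt_def)
      obtain i where i: "i \<le> n" "p i \<le> v" "v \<le> p (Suc i)"
        using located[OF v(1)] ef(1) M(1) EH(1) by blast
      have "i \<in> T e" "i \<in> T f"
        using ef(1,2) M(1) v i by (auto intro: inT)
      then show False
        using pairwiseD[OF M(2) ef] by (auto simp: disjnt_def)
    qed
    then have "matching H M"
      using M(1) EH by (auto simp: matching_def pairwise_def)
    then have cM: "card M \<le> nu H"
      by (rule card_matching_le_nu[OF finH])
    \<comment> \<open>This makes the truncated subtraction on natural numbers agree with the real
      one.\<close>
    have "d \<le> d ^ 2"
      using assms(1) by (simp add: power2_eq_square)
    then have coeff: "real (d ^ 2 - d + 1) = real d ^ 2 - real d + 1"
      by (simp add: of_nat_diff)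
    have "real (tau H) \<le> (real d ^ 2 - real d + 1) * real (card M)"
      using Suc total M(3) by simp
    also have "\<dots> = real ((d ^ 2 - d + 1) * card M)"
      by (simp only: of_nat_mult coeff)
    finally have "tau H \<le> (d ^ 2 - d + 1) * card M"
      by (simp only: of_nat_le_iff)
    then show ?thesis
      using cM by (meson mult_le_mono2 order_trans)
  qed
  moreover have "real (tau H) \<le> real d * nu_star H"
  proof -
    \<comment> \<open>The load at a point is dominated by the load of a piece containing it.\<close>
    have "(\<Sum>h\<in>{h\<in>H. v \<in> h}. w h) \<le> 1" for v
    proof (cases "v \<in> \<Union>H")
      case True
      then obtain i where i: "i \<le> n" "p i \<le> v" "v \<le> p (Suc i)"
        using located by blast
      have "(\<Sum>h\<in>{h\<in>H. v \<in> h}. w h) = (\<Sum>h\<in>{h\<in>E. v \<in> h}. w h)"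
        by (simp add: sumE)
      also have "\<dots> \<le> (\<Sum>h\<in>{h\<in>E. i \<in> T h}. w h)"
        using EH i w0 inT by (intro sum_mono2) auto
      finally show ?thesis
        using load i by simp
    next
      case False
      then have "{h\<in>H. v \<in> h} = {}"
        by blast
      then show ?thesis
        by (simp only: sum.empty zero_le_one)
    qed
    then have "fractional_matching H w"
      using w0 by (simp add: fractional_matching_def)
    then have "sum w H \<le> nu_star H"
      using sum_fractional_matching_le_nu_star finH neH by blast
    moreover have "sum w E = sum w H"
      using sumE[of "\<lambda>_. True"] by simp
    ultimately have "real d * sum w E \<le> real d * nu_star H"
      by (simp add: mult_left_mono)
    then show ?thesis
      using total Suc by simp
  qed
  ultimately show ?thesis ..
qed

end
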